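(* Let $\{p_\theta:\theta\in\Theta\}$ be a model that is doubly differentiable in quadratic mean (DDQM) at some $\theta\in\Theta$, let $\mathcal{M}_1,\mathcal{M}_2\subset\Theta$ be submodels with $\theta\in\mathcal{M}_1\cap\mathcal{M}_2$, and let $c>0$. If $\mathcal{M}_1,\mathcal{M}_2$ are $c$-equivalent (respectively $c$-near-equivalent) at $\theta$, then they cannot be asymptotically distinguished under local alternatives to $\theta$ of order $O(n^{-\frac1{2c}})$ (respectively $o(n^{-\frac1{2c}})$). That is, for every sequence $h_n$ with $\theta+h_n\in\mathcal{M}_1$ and $h_n=O(n^{-\frac1{2c}})$ (respectively $h_n=o(n^{-\frac1{2c}})$) there is a sequence $\tilde h_n$ with $\theta+\tilde h_n\in\mathcal{M}_2$ such that, for $n$ independent observations from $p_{\theta+\tilde h_n}$ with log-likelihood $\ell_n$, $\ell_n(\theta+h_n)-\ell_n(\theta+\tilde h_n)\to0$ in probability; and the same holds with the roles of $\mathcal{M}_1$ and $\mathcal{M}_2$ exchanged.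
   Context: $\Theta$ is an open subset of $\mathbb{R}^k$; each $P_\theta$ has density $p_\theta$ with respect to a common measure $\mu$; models are subsets of $\Theta$. $\ell_n(\theta)=\sum_{i=1}^n\log p_\theta(X_i)$. $p_\theta$ is DDQM at $\theta$ if for any sequences $h,\tilde h\to0$, $$\int\Big(\sqrt{p_{\theta+h}}-\sqrt{p_{\theta+\tilde h}}-\tfrac12(h-\tilde h)^T\dot\ell(\theta+\tilde h)\sqrt{p_{\theta+\tilde h}}\Big)^2d\mu=o(\|h-\tilde h\|^2),$$ where $\dot\ell(\theta)$ is the score function for one observation. Hausdorff distance: $D(A,B)=\max\{\sup_{a\in A}\inf_{b\in B}\|a-b\|,\ \sup_{b\in B}\inf_{a\in A}\|a-b\|\}$. With $N_\varepsilon(\theta)$ the $\varepsilon$-ball around $\theta$, $\mathcal{M}_1,\mathcal{M}_2$ are $c$-equivalent at $\theta\in\mathcal{M}_1\cap\mathcal{M}_2$ if $D(\mathcal{M}_1\cap N_\varepsilon(\theta),\mathcal{M}_2\cap N_\varepsilon(\theta))=o(\varepsilon^c)$ as $\varepsilon\downarrow0$, and $c$-near-equivalent at $\theta$ if this distance is $O(\varepsilon^c)$. *)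

theory Defs
  imports "HOL-Probability.Probability" "HOL-Library.Landau_Symbols"
begin

definition density_family ::
  "'a measure \<Rightarrow> 'p set \<Rightarrow> ('p \<Rightarrow> 'a \<Rightarrow> real) \<Rightarrow> bool" where
  "density_family M \<Theta> p \<longleftrightarrow>
     (\<forall>\<theta>\<in>\<Theta>. p \<theta> \<in> borel_measurable M \<and> (\<forall>x\<in>space M. 0 \<le> p \<theta> x)
        \<and> (\<integral>\<^sup>+ x. ennreal (p \<theta> x) \<partial>M) = 1)"

text \<open>
  The score is a parameter: as usual for differentiability in quadratic mean, it is only required
  to satisfy the expansion, and \<open>p\<close> need not be pointwise differentiable in the parameter.
  The classical gradient of the log-likelihood is one possible instance.
  Integrability is stated explicitly because the integral of a non-integrable function is \<open>0\<close>.
\<close>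

definition ddqm_remainder ::
  "('p::real_inner \<Rightarrow> 'a \<Rightarrow> real) \<Rightarrow> ('p \<Rightarrow> 'a \<Rightarrow> 'p) \<Rightarrow> 'p \<Rightarrow> 'p \<Rightarrow> 'p \<Rightarrow> 'a \<Rightarrow> real" where
  "ddqm_remainder p score \<theta> h h' x =
     sqrt (p (\<theta> + h) x) - sqrt (p (\<theta> + h') x)
       - 1/2 * ((h - h') \<bullet> score (\<theta> + h') x) * sqrt (p (\<theta> + h') x)"

definition ddqm_at ::
  "'a measure \<Rightarrow> ('p::euclidean_space \<Rightarrow> 'a \<Rightarrow> real) \<Rightarrow> ('p \<Rightarrow> 'a \<Rightarrow> 'p) \<Rightarrow> 'p \<Rightarrow> bool" where
  "ddqm_at M p score \<theta> \<longleftrightarrow>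
     (\<forall>\<^sub>F \<theta>' in nhds \<theta>. score \<theta>' \<in> borel_measurable M) \<and>
     (\<forall>h h' :: nat \<Rightarrow> 'p. h \<longlonglongrightarrow> 0 \<longrightarrow> h' \<longlonglongrightarrow> 0 \<longrightarrow>
        (\<forall>\<^sub>F n in sequentially. integrable M (\<lambda>x. (ddqm_remainder p score \<theta> (h n) (h' n) x)\<^sup>2)) \<and>
        (\<lambda>n. \<integral>x. (ddqm_remainder p score \<theta> (h n) (h' n) x)\<^sup>2 \<partial>M) \<in> o(\<lambda>n. (norm (h n - h' n))\<^sup>2))"

text \<open>
  Only meaningful for nonempty bounded sets: otherwise the suprema over the reals, or \<open>infdist\<close>
  to the empty set, take default values. Below both sets contain the centre of a ball and lie in it.
\<close>

definition hausdorff_dist :: "'p::metric_space set \<Rightarrow> 'p set \<Rightarrow> real" where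
  "hausdorff_dist A B = max (SUP a\<in>A. infdist a B) (SUP b\<in>B. infdist b A)"

definition c_equivalent_at :: "real \<Rightarrow> 'p::metric_space \<Rightarrow> 'p set \<Rightarrow> 'p set \<Rightarrow> bool" where
  "c_equivalent_at c \<theta> M1 M2 \<longleftrightarrow>
     (\<lambda>\<epsilon>. hausdorff_dist (M1 \<inter> ball \<theta> \<epsilon>) (M2 \<inter> ball \<theta> \<epsilon>)) \<in> o[at_right 0](\<lambda>\<epsilon>. \<epsilon> powr c)"

definition c_near_equivalent_at :: "real \<Rightarrow> 'p::metric_space \<Rightarrow> 'p set \<Rightarrow> 'p set \<Rightarrow> bool" where
  "c_near_equivalent_at c \<theta> M1 M2 \<longleftrightarrow>
     (\<lambda>\<epsilon>. hausdorff_dist (M1 \<inter> ball \<theta> \<epsilon>) (M2 \<inter> ball \<theta> \<epsilon>)) \<in> O[at_right 0](\<lambda>\<epsilon>. \<epsilon> powr c)"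

text \<open>
  The log-likelihood is extended-real valued, with \<open>log 0 = -\<infinity>\<close>; with the convention
  \<open>ln 0 = 0\<close> an observation that is impossible under \<open>\<theta>\<close> would be ignored.
\<close>

definition log_density :: "('p \<Rightarrow> 'a \<Rightarrow> real) \<Rightarrow> 'p \<Rightarrow> 'a \<Rightarrow> ereal" where
  "log_density p \<theta> x = (if p \<theta> x = 0 then -\<infinity> else ereal (ln (p \<theta> x)))"

definition log_lik :: "('p \<Rightarrow> 'a \<Rightarrow> real) \<Rightarrow> nat \<Rightarrow> 'p \<Rightarrow> (nat \<Rightarrow> 'a) \<Rightarrow> ereal" where
  "log_lik p n \<theta> X = (\<Sum>i<n. log_density p \<theta> (X i))"

definition iid_law :: "'a measure \<Rightarrow> ('p \<Rightarrow> 'a \<Rightarrow> real) \<Rightarrow> nat \<Rightarrow> 'p \<Rightarrow> (nat \<Rightarrow> 'a) measure" where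
  "iid_law M p n \<theta> = PiM {..<n} (\<lambda>_. density M (\<lambda>x. ennreal (p \<theta> x)))"

text \<open>
  Convergence in probability along a triangular array: the law of the sample changes with \<open>n\<close>.
  The value of \<open>-\<infinity> - (-\<infinity>)\<close> is immaterial, since the second term is finite almost surely.
\<close>

definition loglik_diff_vanishes ::
  "'a measure \<Rightarrow> ('p \<Rightarrow> 'a \<Rightarrow> real) \<Rightarrow> (nat \<Rightarrow> 'p) \<Rightarrow> (nat \<Rightarrow> 'p) \<Rightarrow> bool" where
  "loglik_diff_vanishes M p \<theta>1 \<theta>2 \<longleftrightarrow>
     (\<forall>\<epsilon>>0. (\<lambda>n. measure (iid_law M p n (\<theta>2 n))
        {X \<in> space (iid_law M p n (\<theta>2 n)).
           \<bar>log_lik p n (\<theta>1 n) X - log_lik p n (\<theta>2 n) X\<bar> > ereal \<epsilon>}) \<longlonglongrightarrow> 0)"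

text \<open>
  \<open>R\<close> is the class of admissible rates for the norms of the local alternatives, such as
  \<open>O(n\<^sup>-\<^sup>a)\<close> or \<open>o(n\<^sup>-\<^sup>a)\<close>.
\<close>

definition locally_mimicked ::
  "'a measure \<Rightarrow> ('p::real_normed_vector \<Rightarrow> 'a \<Rightarrow> real) \<Rightarrow> 'p \<Rightarrow> (nat \<Rightarrow> real) set
     \<Rightarrow> 'p set \<Rightarrow> 'p set \<Rightarrow> bool" where
  "locally_mimicked M p \<theta> R M1 M2 \<longleftrightarrow>
     (\<forall>h. (\<forall>n. \<theta> + h n \<in> M1) \<longrightarrow> (\<lambda>n. norm (h n)) \<in> R \<longrightarrow>
        (\<exists>h'. (\<forall>n. \<theta> + h' n \<in> M2) \<and>
              loglik_diff_vanishes M p (\<lambda>n. \<theta> + h n) (\<lambda>n. \<theta> + h' n)))"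

definition not_asymp_distinguishable ::
  "'a measure \<Rightarrow> ('p::real_normed_vector \<Rightarrow> 'a \<Rightarrow> real) \<Rightarrow> 'p \<Rightarrow> (nat \<Rightarrow> real) set
     \<Rightarrow> 'p set \<Rightarrow> 'p set \<Rightarrow> bool" where
  "not_asymp_distinguishable M p \<theta> R M1 M2 \<longleftrightarrow>
     locally_mimicked M p \<theta> R M1 M2 \<and> locally_mimicked M p \<theta> R M2 M1"

end

theory Submission
  imports Defs "HOL-Real_Asymp.Real_Asymp"
begin

text \<open>
  The quadratic-mean expansion makes the map \<open>\<theta>' \<mapsto> \<surd>p\<^sub>\<theta>\<^sub>'\<close> Lipschitz near \<open>\<theta>\<close>, as a map
  into \<open>L\<^sup>2\<close>. Indeed it says that the root density changes by a linear term, given by the score,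
  up to a remainder of smaller order. For a step of fixed length the change is bounded, because
  densities have mass \<open>1\<close>; this bounds the linear term uniformly in the base point, and linearity
  carries the bound over to arbitrarily short steps (lemma \<open>ddqm_locally_lipschitz\<close>).

  Hence if \<open>\<parallel>h\<^sub>n - h'\<^sub>n\<parallel> = o(n\<^sup>-\<^sup>1\<^sup>/\<^sup>2)\<close>, the squared Hellinger distance between the two laws of a
  single observation is \<open>o(1/n)\<close>. The affinity \<open>\<integral>\<surd>(f g)\<close> of product measures is multiplicative, so the square
  root of the likelihood ratio of \<open>n\<close> observations, seen as a random variable under
  \<open>\<theta> + h'\<^sub>n\<close>, converges to \<open>1\<close> in \<open>L\<^sup>2\<close>, and the log-likelihood ratio converges to \<open>0\<close> in
  probability (lemmas \<open>loglik_diff_tail_bound\<close> and \<open>loglik_diff_vanishes_if_close\<close>).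

  The geometry enters only through the choice of \<open>h'\<^sub>n\<close>: take a radius \<open>\<epsilon>\<^sub>n\<close> just larger than
  \<open>\<parallel>h\<^sub>n\<parallel>\<close> and an almost closest point of the other model in the ball of that radius. Up to a slack of
  order \<open>1/n\<close>, the gap is at most the Hausdorff distance at scale \<open>\<epsilon>\<^sub>n\<close>. Both rate
  assumptions are made so that the composition is \<open>o(n\<^sup>-\<^sup>1\<^sup>/\<^sup>2)\<close>: either the Hausdorff distance is \<open>o(\<epsilon>\<^sup>c)\<close> and
  \<open>\<epsilon>\<^sub>n\<^sup>c = O(n\<^sup>-\<^sup>1\<^sup>/\<^sup>2)\<close>, or the symbols \<open>o\<close> and \<open>O\<close> change places.
\<close>

section \<open>Affinity and Hellinger distance\<close>

definition prob_density :: "'a measure \<Rightarrow> ('a \<Rightarrow> real) \<Rightarrow> bool" where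
  "prob_density M f \<longleftrightarrow>
     f \<in> borel_measurable M \<and> (\<forall>x\<in>space M. 0 \<le> f x) \<and> (\<integral>\<^sup>+ x. ennreal (f x) \<partial>M) = 1"

lemma density_family_iff: "density_family M \<Theta> p \<longleftrightarrow> (\<forall>\<theta>\<in>\<Theta>. prob_density M (p \<theta>))"
  by (simp add: density_family_def prob_density_def)

lemma prob_density_measurable [measurable_dest]: "prob_density M f \<Longrightarrow> f \<in> borel_measurable M"
  by (simp add: prob_density_def)

lemma prob_density_nonneg: "prob_density M f \<Longrightarrow> x \<in> space M \<Longrightarrow> 0 \<le> f x"
  by (simp add: prob_density_def)

lemma prob_density_has_integral:
  assumes "prob_density M f"
  shows "integrable M f" "(\<integral>x. f x \<partial>M) = 1"
proof -
  have ae: "AE x in M. 0 \<le> f x"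
    using assms by (auto simp: prob_density_def)
  have m: "f \<in> borel_measurable M" and nn: "(\<integral>\<^sup>+ x. ennreal (f x) \<partial>M) = 1"
    using assms by (auto simp: prob_density_def)
  show "integrable M f"
    using m ae nn by (intro integrableI_nonneg) auto
  show "(\<integral>x. f x \<partial>M) = 1"
    using integral_eq_nn_integral[OF m ae] nn by simp
qed

lemma prob_space_prob_density:
  assumes "prob_density M f"
  shows "prob_space (density M (\<lambda>x. ennreal (f x)))"
proof
  have "f \<in> borel_measurable M"
    using assms by (simp add: prob_density_def)
  then show "emeasure (density M (\<lambda>x. ennreal (f x))) (space (density M (\<lambda>x. ennreal (f x)))) = 1"
    using assms by (simp add: emeasure_density prob_density_def cong: nn_integral_cong)
qed

text \<open>Unnormalised, without the factor \<open>1/2\<close>, so that it is the squared \<open>L\<^sup>2\<close> distance.\<close>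

definition sq_hellinger :: "'a measure \<Rightarrow> ('a \<Rightarrow> real) \<Rightarrow> ('a \<Rightarrow> real) \<Rightarrow> real" where
  "sq_hellinger M f g = (\<integral>x. (sqrt (f x) - sqrt (g x))\<^sup>2 \<partial>M)"

lemma affinity_integrable:
  assumes f: "prob_density M f" and g: "prob_density M g"
  shows "integrable M (\<lambda>x. sqrt (f x * g x))"
proof (rule Bochner_Integration.integrable_bound)
  show "integrable M (\<lambda>x. f x + g x)"
    using prob_density_has_integral(1)[OF f] prob_density_has_integral(1)[OF g] by simp
  show "(\<lambda>x. sqrt (f x * g x)) \<in> borel_measurable M"
    using f g by measurable
  have "norm (sqrt (f x * g x)) \<le> norm (f x + g x)" if "x \<in> space M" for x
  proof -
    have "0 \<le> f x" "0 \<le> g x"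
      using that f g by (auto simp: prob_density_nonneg)
    then show ?thesis
      using arith_geo_mean_sqrt[of "f x" "g x"] by simp
  qed
  then show "AE x in M. norm (sqrt (f x * g x)) \<le> norm (f x + g x)"
    by simp
qed

lemma sqrt_diff_sq:
  fixes a b :: real
  assumes "0 \<le> a" "0 \<le> b"
  shows "(sqrt a - sqrt b)\<^sup>2 = a + b - 2 * sqrt (a * b)"
  using assms by (simp add: power2_diff real_sqrt_mult)

lemma sq_hellinger_integrable:
  assumes f: "prob_density M f" and g: "prob_density M g"
  shows "integrable M (\<lambda>x. (sqrt (f x) - sqrt (g x))\<^sup>2)"
proof -
  have "integrable M (\<lambda>x. f x + g x - 2 * sqrt (f x * g x))"
    using prob_density_has_integral(1)[OF f] prob_density_has_integral(1)[OF g]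
      affinity_integrable[OF f g] by simp
  moreover have "integrable M (\<lambda>x. (sqrt (f x) - sqrt (g x))\<^sup>2)
      \<longleftrightarrow> integrable M (\<lambda>x. f x + g x - 2 * sqrt (f x * g x))"
    using f g by (intro Bochner_Integration.integrable_cong refl sqrt_diff_sq)
      (auto simp: prob_density_nonneg)
  ultimately show ?thesis by simp
qed

lemma sq_hellinger_affinity:
  assumes f: "prob_density M f" and g: "prob_density M g"
  shows "sq_hellinger M f g = 2 - 2 * (\<integral>x. sqrt (f x * g x) \<partial>M)"
proof -
  have "sq_hellinger M f g = (\<integral>x. f x + g x - 2 * sqrt (f x * g x) \<partial>M)"
    unfolding sq_hellinger_def using f g
    by (intro Bochner_Integration.integral_cong refl sqrt_diff_sq) (auto simp: prob_density_nonneg)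
  also have "\<dots> = 2 - 2 * (\<integral>x. sqrt (f x * g x) \<partial>M)"
    using prob_density_has_integral[OF f] prob_density_has_integral[OF g]
      affinity_integrable[OF f g] by simp
  finally show ?thesis .
qed

lemma affinity_nonneg:
  assumes "prob_density M f" "prob_density M g"
  shows "0 \<le> (\<integral>x. sqrt (f x * g x) \<partial>M)"
  using assms by (intro Bochner_Integration.integral_nonneg) (auto simp: prob_density_nonneg)

section \<open>Lipschitz continuity of root densities\<close>

text \<open>
  A little-o statement along all pairs of null sequences is the same as a bound that is uniform on
  a neighbourhood: violations at distance below \<open>1/(n+1)\<close> for every \<open>n\<close> would form a pair of
  sequences that contradicts it.
\<close>

lemma ddqm_uniform_remainder:
  assumes "ddqm_at M p score \<theta>"
  obtains \<delta> where "\<delta> > 0"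
    and "\<And>h h'. norm h < \<delta> \<Longrightarrow> norm h' < \<delta> \<Longrightarrow>
           integrable M (\<lambda>x. (ddqm_remainder p score \<theta> h h' x)\<^sup>2) \<and>
           (\<integral>x. (ddqm_remainder p score \<theta> h h' x)\<^sup>2 \<partial>M) \<le> (norm (h - h'))\<^sup>2"
proof -
  define good where "good h h' \<longleftrightarrow> integrable M (\<lambda>x. (ddqm_remainder p score \<theta> h h' x)\<^sup>2) \<and>
           (\<integral>x. (ddqm_remainder p score \<theta> h h' x)\<^sup>2 \<partial>M) \<le> (norm (h - h'))\<^sup>2" for h h'
  have "\<exists>\<delta>>0. \<forall>h h'. norm h < \<delta> \<longrightarrow> norm h' < \<delta> \<longrightarrow> good h h'"
  proof (rule ccontr)
    assume neg: "\<not> ?thesis"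
    have "\<exists>h h'. norm h < inverse (real (Suc n)) \<and> norm h' < inverse (real (Suc n)) \<and> \<not> good h h'"
      for n
    proof -
      have "inverse (real (Suc n)) > 0" by simp
      with neg show ?thesis by blast
    qed
    then obtain h h' where hh: "\<And>n. norm (h n) < inverse (real (Suc n))"
        "\<And>n. norm (h' n) < inverse (real (Suc n))" "\<And>n. \<not> good (h n) (h' n)"
      by metis
    have "h \<longlonglongrightarrow> 0" "h' \<longlonglongrightarrow> 0"
      using hh(1,2)
      by (auto intro!: Lim_null_comparison[OF _ LIMSEQ_inverse_real_of_nat] always_eventually
               intro: less_imp_le)
    with assms have int: "\<forall>\<^sub>F n in sequentially.
          integrable M (\<lambda>x. (ddqm_remainder p score \<theta> (h n) (h' n) x)\<^sup>2)"
      and small: "(\<lambda>n. \<integral>x. (ddqm_remainder p score \<theta> (h n) (h' n) x)\<^sup>2 \<partial>M)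
          \<in> o(\<lambda>n. (norm (h n - h' n))\<^sup>2)"
      unfolding ddqm_at_def by blast+
    have "\<forall>\<^sub>F n in sequentially. good (h n) (h' n)"
      using int landau_o.smallD[OF small zero_less_one]
    proof eventually_elim
      case (elim n)
      then show ?case by (simp add: good_def)
    qed
    then show False
      using hh(3) by simp
  qed
  then show thesis
    using that unfolding good_def by blast
qed

lemma sq_sum_le:
  fixes a b :: real
  shows "(a + b)\<^sup>2 \<le> 2 * a\<^sup>2 + 2 * b\<^sup>2"
  using sum_squares_bound[of a b] by (simp add: power2_sum)

lemma sq_sum_integral_le:
  fixes f g :: "'a \<Rightarrow> real"
  assumes f: "integrable M (\<lambda>x. (f x)\<^sup>2)" and g: "integrable M (\<lambda>x. (g x)\<^sup>2)"
    and m: "(\<lambda>x. (f x + g x)\<^sup>2) \<in> borel_measurable M"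
  shows "integrable M (\<lambda>x. (f x + g x)\<^sup>2)"
    and "(\<integral>x. (f x + g x)\<^sup>2 \<partial>M) \<le> 2 * (\<integral>x. (f x)\<^sup>2 \<partial>M) + 2 * (\<integral>x. (g x)\<^sup>2 \<partial>M)"
proof -
  have b: "integrable M (\<lambda>x. 2 * (f x)\<^sup>2 + 2 * (g x)\<^sup>2)"
    using f g by simp
  show i: "integrable M (\<lambda>x. (f x + g x)\<^sup>2)"
    by (rule Bochner_Integration.integrable_bound[OF b m]) (simp add: sq_sum_le)
  have "(\<integral>x. (f x + g x)\<^sup>2 \<partial>M) \<le> (\<integral>x. 2 * (f x)\<^sup>2 + 2 * (g x)\<^sup>2 \<partial>M)"
    by (intro integral_mono i b sq_sum_le)
  then show "(\<integral>x. (f x + g x)\<^sup>2 \<partial>M) \<le> 2 * (\<integral>x. (f x)\<^sup>2 \<partial>M) + 2 * (\<integral>x. (g x)\<^sup>2 \<partial>M)"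
    using f g by simp
qed

text \<open>
  The expansion itself bounds the second moment of the score: along a step of fixed length
  \<open>\<delta>\<close> the linear term is the difference of two functions bounded in \<open>L\<^sup>2\<close>, the change of the
  root density and the remainder. The linear term is homogeneous in the step, so a shorter step in
  the same direction scales this bound down, uniformly in the base point \<open>h'\<close>.
\<close>

lemma ddqm_locally_lipschitz:
  fixes p :: "'p::euclidean_space \<Rightarrow> 'a \<Rightarrow> real"
  assumes "open \<Theta>" and fam: "density_family M \<Theta> p" and "\<theta> \<in> \<Theta>"
    and ddqm: "ddqm_at M p score \<theta>"
  obtains \<delta> C where "\<delta> > 0"
    and "\<And>h h'. norm h < \<delta> \<Longrightarrow> norm h' < \<delta> \<Longrightarrow>
           sq_hellinger M (p (\<theta> + h)) (p (\<theta> + h')) \<le> C * (norm (h - h'))\<^sup>2"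
proof -
  obtain \<delta>1 where \<delta>1: "\<delta>1 > 0"
    and rem: "\<And>h h'. norm h < \<delta>1 \<Longrightarrow> norm h' < \<delta>1 \<Longrightarrow>
           integrable M (\<lambda>x. (ddqm_remainder p score \<theta> h h' x)\<^sup>2) \<and>
           (\<integral>x. (ddqm_remainder p score \<theta> h h' x)\<^sup>2 \<partial>M) \<le> (norm (h - h'))\<^sup>2"
    using ddqm_uniform_remainder[OF ddqm] by metis
  obtain \<delta>2 where \<delta>2: "\<delta>2 > 0" "\<And>\<theta>'. dist \<theta>' \<theta> < \<delta>2 \<Longrightarrow> score \<theta>' \<in> borel_measurable M"
    using ddqm unfolding ddqm_at_def eventually_nhds_metric by blast
  obtain \<delta>3 where \<delta>3: "\<delta>3 > 0" "ball \<theta> \<delta>3 \<subseteq> \<Theta>"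
    using \<open>open \<Theta>\<close> \<open>\<theta> \<in> \<Theta>\<close> openE by blast
  define \<delta> where "\<delta> = min \<delta>1 (min \<delta>2 \<delta>3) / 2"
  have \<delta>: "\<delta> > 0" "2 * \<delta> \<le> \<delta>1" "2 * \<delta> \<le> \<delta>2" "2 * \<delta> \<le> \<delta>3"
    using \<delta>1 \<delta>2(1) \<delta>3(1) by (auto simp: \<delta>_def)
  have dens: "prob_density M (p (\<theta> + h))" if "norm h < 2 * \<delta>" for h
  proof -
    have "\<theta> + h \<in> ball \<theta> \<delta>3"
      using that \<delta> by (simp add: dist_norm)
    then show ?thesis
      using fam \<delta>3(2) by (auto simp: density_family_iff)
  qed
  have meas: "score (\<theta> + h) \<in> borel_measurable M" if "norm h < 2 * \<delta>" for h
    using that \<delta> by (intro \<delta>2(2)) (simp add: dist_norm)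
  define lin where "lin u h' x = 1/2 * (u \<bullet> score (\<theta> + h') x) * sqrt (p (\<theta> + h') x)" for u h' x
  \<comment> \<open>Each use of \<open>(a + b)\<^sup>2 \<le> 2a\<^sup>2 + 2b\<^sup>2\<close> contributes a factor \<open>2\<close>. Squared \<open>L\<^sup>2\<close> distances
    of root densities are at most \<open>2\<close>, which gives \<open>4 + 2\<delta>\<^sup>2\<close> for a linear term of step length
    \<open>\<delta>\<close>; the last summand is the remainder of the short step.\<close>
  define C where "C = 2 * ((4 + 2 * \<delta>\<^sup>2) / \<delta>\<^sup>2) + 2"
  have bound_lin: "integrable M (\<lambda>x. (lin u h' x)\<^sup>2) \<and> (\<integral>x. (lin u h' x)\<^sup>2 \<partial>M) \<le> 4 + 2 * \<delta>\<^sup>2"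
    if u: "norm u = \<delta>" and h': "norm h' < \<delta>" for u h'
  proof -
    have n: "norm (h' + u) < 2 * \<delta>" "norm h' < 2 * \<delta>"
      using norm_triangle_ineq[of h' u] u h' \<delta>(1) by auto
    note d = dens[OF n(1)] dens[OF n(2)]
    have r: "integrable M (\<lambda>x. (ddqm_remainder p score \<theta> (h' + u) h' x)\<^sup>2)"
      "(\<integral>x. (ddqm_remainder p score \<theta> (h' + u) h' x)\<^sup>2 \<partial>M) \<le> \<delta>\<^sup>2"
      using rem[of "h' + u" h'] n \<delta> u by auto
    have eq: "lin u h' x = (sqrt (p (\<theta> + (h' + u)) x) - sqrt (p (\<theta> + h') x))
        + (- ddqm_remainder p score \<theta> (h' + u) h' x)" for x
      by (simp add: lin_def ddqm_remainder_def)
    have m: "(\<lambda>x. (lin u h' x)\<^sup>2) \<in> borel_measurable M"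
      unfolding lin_def using meas[OF n(2)] d by measurable
    have "sq_hellinger M (p (\<theta> + (h' + u))) (p (\<theta> + h')) \<le> 2"
      using sq_hellinger_affinity[OF d] affinity_nonneg[OF d] by simp
    moreover note sq_sum_integral_le[OF sq_hellinger_integrable[OF d], of
        "\<lambda>x. - ddqm_remainder p score \<theta> (h' + u) h' x", folded eq, OF _ m]
    ultimately show ?thesis
      using r by (simp add: sq_hellinger_def)
  qed
  have "sq_hellinger M (p (\<theta> + h)) (p (\<theta> + h')) \<le> C * (norm (h - h'))\<^sup>2"
    if h: "norm h < \<delta>" "norm h' < \<delta>" for h h'
  proof (cases "h = h'")
    case True
    then show ?thesis by (simp add: sq_hellinger_def)
  next
    case False
    define t where "t = norm (h - h') / \<delta>"
    define u where "u = (1 / t) *\<^sub>R (h - h')"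
    have t: "t > 0" using False \<delta>(1) by (simp add: t_def)
    have u: "norm u = \<delta>" using False \<delta>(1) by (simp add: u_def t_def)
    have tu: "h - h' = t *\<^sub>R u" using t by (simp add: u_def)
    have lin_t: "(lin (h - h') h' x)\<^sup>2 = t\<^sup>2 * (lin u h' x)\<^sup>2" for x
      by (simp add: tu lin_def power_mult_distrib power_divide)
    have n: "norm h < 2 * \<delta>" "norm h' < 2 * \<delta>" using h \<delta>(1) by auto
    have l: "integrable M (\<lambda>x. (lin (h - h') h' x)\<^sup>2)"
      "(\<integral>x. (lin (h - h') h' x)\<^sup>2 \<partial>M) \<le> t\<^sup>2 * (4 + 2 * \<delta>\<^sup>2)"
      using bound_lin[OF u h(2)] by (auto simp: lin_t intro!: mult_left_mono)
    have r: "integrable M (\<lambda>x. (ddqm_remainder p score \<theta> h h' x)\<^sup>2)"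
      "(\<integral>x. (ddqm_remainder p score \<theta> h h' x)\<^sup>2 \<partial>M) \<le> (norm (h - h'))\<^sup>2"
      using rem[of h h'] n \<delta> by auto
    have eq: "sqrt (p (\<theta> + h) x) - sqrt (p (\<theta> + h') x)
        = lin (h - h') h' x + ddqm_remainder p score \<theta> h h' x" for x
      by (simp add: lin_def ddqm_remainder_def)
    have m: "(\<lambda>x. (sqrt (p (\<theta> + h) x) - sqrt (p (\<theta> + h') x))\<^sup>2) \<in> borel_measurable M"
      using dens[OF n(1)] dens[OF n(2)] by measurable
    have "sq_hellinger M (p (\<theta> + h)) (p (\<theta> + h'))
        \<le> 2 * (\<integral>x. (lin (h - h') h' x)\<^sup>2 \<partial>M) + 2 * (\<integral>x. (ddqm_remainder p score \<theta> h h' x)\<^sup>2 \<partial>M)"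
      unfolding sq_hellinger_def using sq_sum_integral_le(2)[OF l(1) r(1)] m by (simp add: eq)
    also have "\<dots> \<le> 2 * (t\<^sup>2 * (4 + 2 * \<delta>\<^sup>2)) + 2 * (norm (h - h'))\<^sup>2"
      using l(2) r(2) by simp
    also have "\<dots> = C * (norm (h - h'))\<^sup>2"
      by (simp add: C_def t_def power_divide field_simps)
    finally show ?thesis .
  qed
  then show thesis using that \<delta>(1) by blast
qed

section \<open>Likelihood ratios of nearby product laws\<close>

text \<open>
  Under the law with density \<open>g\<close>, the product of \<open>\<surd>(f/g)\<close> over the sample has second moment
  at most \<open>1\<close> and mean equal to the \<open>n\<close>-th power of the affinity, which by Bernoulli's
  inequality is at least \<open>1 - n H\<^sup>2/2\<close>. Expanding the square leaves \<open>n H\<^sup>2\<close>.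
\<close>

lemma root_likelihood_ratio_near_one:
  fixes n :: nat
  assumes f: "prob_density M f" and g: "prob_density M g"
  defines "Q \<equiv> PiM {..<n} (\<lambda>_. density M (\<lambda>x. ennreal (g x)))"
  shows "integrable Q (\<lambda>X. ((\<Prod>i<n. sqrt (f (X i) / g (X i))) - 1)\<^sup>2)"
    and "(\<integral>X. ((\<Prod>i<n. sqrt (f (X i) / g (X i))) - 1)\<^sup>2 \<partial>Q) \<le> real n * sq_hellinger M f g"
proof -
  let ?G = "density M (\<lambda>x. ennreal (g x))"
  define r where "r x = sqrt (f x / g x)" for x
  have [measurable]: "f \<in> borel_measurable M" "g \<in> borel_measurable M"
    using f g by (auto simp: prob_density_def)
  interpret G: prob_space ?G by (rule prob_space_prob_density[OF g])
  interpret P: product_prob_space "\<lambda>_::nat. ?G" ..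
  interpret Q: prob_space Q unfolding Q_def by (rule prob_space_PiM) (rule G.prob_space_axioms)
  have [measurable]: "r \<in> borel_measurable M"
    unfolding r_def by measurable
  have nonneg: "AE x in M. 0 \<le> g x" using g by (auto simp: prob_density_nonneg)
  have root: "g x * r x = sqrt (f x * g x)" if "x \<in> space M" for x
  proof -
    have "0 \<le> g x"
      using that g by (simp add: prob_density_nonneg)
    have "g x * r x = sqrt (f x) * (g x / sqrt (g x))"
      by (simp add: r_def real_sqrt_divide)
    also have "\<dots> = sqrt (f x * g x)"
      using \<open>0 \<le> g x\<close> by (simp only: real_div_sqrt real_sqrt_mult)
    finally show ?thesis .
  qed
  have square: "0 \<le> g x * (r x)\<^sup>2 \<and> g x * (r x)\<^sup>2 \<le> f x" if "x \<in> space M" for x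
    using that f g by (simp add: r_def prob_density_nonneg)
  have int1: "integrable ?G r"
    unfolding r_def
  proof (subst integrable_density)
    show "integrable M (\<lambda>x. g x *\<^sub>R sqrt (f x / g x))"
      using affinity_integrable[OF f g] root
      by (subst Bochner_Integration.integrable_cong[OF refl, where g="\<lambda>x. sqrt (f x * g x)"])
        (auto simp: r_def)
  qed (use nonneg in measurable)
  have mean: "(\<integral>x. r x \<partial>?G) = (\<integral>x. sqrt (f x * g x) \<partial>M)"
    using root nonneg by (subst integral_density) (auto simp: r_def intro!: Bochner_Integration.integral_cong)
  have bnd: "integrable M (\<lambda>x. g x * (r x)\<^sup>2)"
    by (rule Bochner_Integration.integrable_bound[OF prob_density_has_integral(1)[OF f]])
      (use square f in \<open>auto simp: r_def prob_density_nonneg\<close>)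
  have int2: "integrable ?G (\<lambda>x. (r x)\<^sup>2)"
    using nonneg bnd by (subst integrable_density) (auto simp: r_def)
  have "(\<integral>x. (r x)\<^sup>2 \<partial>?G) = (\<integral>x. g x * (r x)\<^sup>2 \<partial>M)"
    using nonneg by (subst integral_density) (auto simp: r_def)
  also have "\<dots> \<le> (\<integral>x. f x \<partial>M)"
    using square by (intro integral_mono bnd prob_density_has_integral(1)[OF f]) auto
  finally have second: "(\<integral>x. (r x)\<^sup>2 \<partial>?G) \<le> 1"
    using prob_density_has_integral(2)[OF f] by simp
  define R where "R X = (\<Prod>i<n. r (X i))" for X
  have R: "integrable Q R" "(\<integral>X. R X \<partial>Q) = (\<integral>x. sqrt (f x * g x) \<partial>M) ^ n"
    unfolding R_def Q_def
    using P.product_integrable_prod[of "{..<n}" "\<lambda>_. r"] P.product_integral_prod[of "{..<n}" "\<lambda>_. r"]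
      int1 mean by auto
  have R2: "integrable Q (\<lambda>X. (R X)\<^sup>2)" "(\<integral>X. (R X)\<^sup>2 \<partial>Q) = (\<integral>x. (r x)\<^sup>2 \<partial>?G) ^ n"
    unfolding R_def Q_def prod_power_distrib
    using P.product_integrable_prod[of "{..<n}" "\<lambda>_ x. (r x)\<^sup>2"]
      P.product_integral_prod[of "{..<n}" "\<lambda>_ x. (r x)\<^sup>2"] int2 by auto
  have exp: "(R X - 1)\<^sup>2 = (R X)\<^sup>2 - 2 * R X + 1" for X
    by (simp add: power2_diff)
  have "integrable Q (\<lambda>X. (R X - 1)\<^sup>2)"
    unfolding exp using R R2 by simp
  then show "integrable Q (\<lambda>X. ((\<Prod>i<n. sqrt (f (X i) / g (X i))) - 1)\<^sup>2)"
    by (simp add: R_def r_def)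
  have "(\<integral>X. (R X - 1)\<^sup>2 \<partial>Q)
      = (\<integral>x. (r x)\<^sup>2 \<partial>?G) ^ n - 2 * (\<integral>x. sqrt (f x * g x) \<partial>M) ^ n + 1"
    unfolding exp using R R2 by (simp add: Q.prob_space)
  also have "\<dots> \<le> 2 - 2 * (\<integral>x. sqrt (f x * g x) \<partial>M) ^ n"
  proof -
    have "(\<integral>x. (r x)\<^sup>2 \<partial>?G) ^ n \<le> 1"
      by (rule power_le_one[OF _ second]) simp
    then show ?thesis by linarith
  qed
  also have "\<dots> \<le> real n * sq_hellinger M f g"
  proof -
    define b where "b = (\<integral>x. sqrt (f x * g x) \<partial>M)"
    have "b \<ge> 0" "sq_hellinger M f g = 2 - 2 * b"
      unfolding b_def by (fact affinity_nonneg[OF f g] sq_hellinger_affinity[OF f g])+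
    moreover have "1 + real n * (b - 1) \<le> b ^ n"
      using Bernoulli_inequality[of "b - 1" n] \<open>b \<ge> 0\<close> by simp
    moreover have "real n * (2 - 2 * b) = 2 - 2 * (1 + real n * (b - 1))"
      by (simp add: algebra_simps)
    ultimately show ?thesis
      unfolding b_def[symmetric] by simp
  qed
  finally show "(\<integral>X. ((\<Prod>i<n. sqrt (f (X i) / g (X i))) - 1)\<^sup>2 \<partial>Q) \<le> real n * sq_hellinger M f g"
    by (simp add: R_def r_def)
qed

text \<open>
  If some observation is impossible under \<open>\<theta>1\<close>, the log-likelihood difference is infinite, but
  the product of roots is \<open>0\<close>, at distance \<open>1\<close> from \<open>1\<close>, so the bound covers this case too. Otherwise the
  log-likelihood ratio is twice the logarithm of the product.
\<close>

lemma loglik_diff_large_imp_root_ratio_far: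
  fixes p :: "'p \<Rightarrow> 'a \<Rightarrow> real"
  assumes pos: "\<And>i. i < n \<Longrightarrow> 0 < p \<theta>2 (X i)" and nn: "\<And>i. i < n \<Longrightarrow> 0 \<le> p \<theta>1 (X i)"
    and large: "\<bar>log_lik p n \<theta>1 X - log_lik p n \<theta>2 X\<bar> > ereal \<epsilon>"
  shows "1 - exp (- \<epsilon> / 2) \<le> \<bar>(\<Prod>i<n. sqrt (p \<theta>1 (X i) / p \<theta>2 (X i))) - 1\<bar>"
proof (cases "\<exists>i<n. p \<theta>1 (X i) = 0")
  case True
  then have zero: "(\<Prod>i<n. sqrt (p \<theta>1 (X i) / p \<theta>2 (X i))) = 0"
    by (intro prod_zero) auto
  show ?thesis
    unfolding zero by simp
next
  case False
  with nn have pos1: "\<And>i. i < n \<Longrightarrow> 0 < p \<theta>1 (X i)"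
    by (metis order_le_less)
  define R where "R = (\<Prod>i<n. sqrt (p \<theta>1 (X i) / p \<theta>2 (X i)))"
  have Rpos: "R > 0"
    unfolding R_def using pos pos1 by (intro prod_pos) auto
  have l: "log_lik p n t X = ereal (\<Sum>i<n. ln (p t (X i)))" if "\<And>i. i < n \<Longrightarrow> 0 < p t (X i)" for t
  proof -
    have "log_lik p n t X = (\<Sum>i<n. ereal (ln (p t (X i))))"
      unfolding log_lik_def log_density_def using that
      by (intro sum.cong refl) (simp add: less_imp_neq[THEN not_sym])
    then show ?thesis by simp
  qed
  have "ln R = (\<Sum>i<n. ln (sqrt (p \<theta>1 (X i) / p \<theta>2 (X i))))"
    unfolding R_def
  proof (rule ln_prod)
    fix i assume "i \<in> {..<n}"
    with pos[of i] pos1[of i] show "sqrt (p \<theta>1 (X i) / p \<theta>2 (X i)) \<noteq> 0" by simp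
  qed simp
  also have "\<dots> = (\<Sum>i<n. (ln (p \<theta>1 (X i)) - ln (p \<theta>2 (X i))) / 2)"
  proof (intro sum.cong refl)
    fix i assume "i \<in> {..<n}"
    then have "p \<theta>1 (X i) > 0" "p \<theta>2 (X i) > 0"
      using pos pos1 by auto
    then show "ln (sqrt (p \<theta>1 (X i) / p \<theta>2 (X i))) = (ln (p \<theta>1 (X i)) - ln (p \<theta>2 (X i))) / 2"
      by (simp add: ln_sqrt ln_div)
  qed
  finally have "2 * ln R = (\<Sum>i<n. ln (p \<theta>1 (X i))) - (\<Sum>i<n. ln (p \<theta>2 (X i)))"
    by (simp add: sum_subtractf flip: sum_divide_distrib)
  then have big: "\<epsilon> < \<bar>2 * ln R\<bar>"
    using large l[OF pos] l[OF pos1] by simp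
  show ?thesis
  proof (cases "ln R > 0")
    case True
    then have "\<epsilon> / 2 < ln R"
      using big by simp
    then have "exp (\<epsilon> / 2) < exp (ln R)"
      by simp
    then have "exp (\<epsilon> / 2) < R"
      using Rpos by simp
    \<comment> \<open>Of the two deviations \<open>e\<^sup>\<epsilon>\<^sup>/\<^sup>2 - 1\<close> and \<open>1 - e\<^sup>-\<^sup>\<epsilon>\<^sup>/\<^sup>2\<close>, the second is the smaller one.\<close>
    moreover have "1 - exp (- \<epsilon> / 2) \<le> exp (\<epsilon> / 2) - 1"
      using exp_ge_add_one_self[of "\<epsilon> / 2"] exp_ge_add_one_self[of "- \<epsilon> / 2"] by linarith
    ultimately show ?thesis by (simp add: R_def)
  next
    case False
    then have "ln R < - \<epsilon> / 2" using big by simp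
    then have "exp (ln R) < exp (- \<epsilon> / 2)"
      by (simp only: exp_less_cancel_iff)
    then have "R < exp (- \<epsilon> / 2)"
      using Rpos by simp
    then show ?thesis by (simp add: R_def)
  qed
qed

lemma loglik_diff_tail_bound:
  assumes f: "prob_density M (p \<theta>1)" and g: "prob_density M (p \<theta>2)" and "\<epsilon> > 0"
  shows "measure (iid_law M p n \<theta>2)
      {X \<in> space (iid_law M p n \<theta>2). \<bar>log_lik p n \<theta>1 X - log_lik p n \<theta>2 X\<bar> > ereal \<epsilon>}
    \<le> real n * sq_hellinger M (p \<theta>1) (p \<theta>2) / (1 - exp (- \<epsilon> / 2))\<^sup>2"
proof -
  let ?Q = "iid_law M p n \<theta>2"
  let ?G = "density M (\<lambda>x. ennreal (p \<theta>2 x))"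
  let ?R = "\<lambda>X. \<Prod>i<n. sqrt (p \<theta>1 (X i) / p \<theta>2 (X i))"
  define \<eta> where "\<eta> = 1 - exp (- \<epsilon> / 2)"
  have \<eta>: "\<eta> > 0" using \<open>\<epsilon> > 0\<close> by (simp add: \<eta>_def)
  have [measurable]: "p \<theta>1 \<in> borel_measurable M" "p \<theta>2 \<in> borel_measurable M"
    using f g by (auto simp: prob_density_def)
  interpret G: prob_space ?G by (rule prob_space_prob_density[OF g])
  interpret P: product_prob_space "\<lambda>_::nat. ?G" ..
  interpret Q: prob_space ?Q unfolding iid_law_def by (rule prob_space_PiM) (rule G.prob_space_axioms)
  note near = root_likelihood_ratio_near_one[OF f g, of n, folded iid_law_def]
  have sp: "p \<theta>1 (X i) \<ge> 0" if "X \<in> space ?Q" "i < n" for X i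
    using that prob_density_nonneg[OF f] by (auto simp: iid_law_def space_PiM PiE_iff)
  have "AE x in ?G. 0 < p \<theta>2 x"
    by (subst AE_density) auto
  then have "AE X in ?Q. \<forall>i\<in>{..<n}. 0 < p \<theta>2 (X i)"
    unfolding iid_law_def
    by (intro AE_finite_allI AE_PiM_component) (auto intro: G.prob_space_axioms)
  then have imp: "AE X in ?Q. X \<in> {X \<in> space ?Q. \<bar>log_lik p n \<theta>1 X - log_lik p n \<theta>2 X\<bar> > ereal \<epsilon>}
      \<longrightarrow> X \<in> {X \<in> space ?Q. \<eta>\<^sup>2 \<le> (?R X - 1)\<^sup>2}"
  proof eventually_elim
    case (elim X)
    show ?case
    proof
      assume "X \<in> {X \<in> space ?Q. \<bar>log_lik p n \<theta>1 X - log_lik p n \<theta>2 X\<bar> > ereal \<epsilon>}"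
      then have X: "X \<in> space ?Q" "\<bar>log_lik p n \<theta>1 X - log_lik p n \<theta>2 X\<bar> > ereal \<epsilon>" by auto
      have "\<eta> \<le> \<bar>?R X - 1\<bar>"
        unfolding \<eta>_def
        by (rule loglik_diff_large_imp_root_ratio_far[where p = p, OF _ _ X(2)])
          (use elim sp[OF X(1)] in auto)
      then have "\<eta>\<^sup>2 \<le> (?R X - 1)\<^sup>2"
        using \<eta> by (metis abs_le_square_iff abs_of_pos)
      with X(1) show "X \<in> {X \<in> space ?Q. \<eta>\<^sup>2 \<le> (?R X - 1)\<^sup>2}" by simp
    qed
  qed
  have [measurable]: "(\<lambda>X. (?R X - 1)\<^sup>2) \<in> borel_measurable ?Q"
    using near(1) by (rule borel_measurable_integrable)
  have "measure ?Q {X \<in> space ?Q. \<bar>log_lik p n \<theta>1 X - log_lik p n \<theta>2 X\<bar> > ereal \<epsilon>}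
      \<le> measure ?Q {X \<in> space ?Q. \<eta>\<^sup>2 \<le> (?R X - 1)\<^sup>2}"
    using imp by (rule Q.finite_measure_mono_AE) measurable
  also have "\<dots> \<le> (\<integral>X. (?R X - 1)\<^sup>2 \<partial>?Q) / \<eta>\<^sup>2"
    using near(1) \<eta> by (intro integral_Markov_inequality_measure[where A = "{}"]) auto
  also have "\<dots> \<le> real n * sq_hellinger M (p \<theta>1) (p \<theta>2) / \<eta>\<^sup>2"
    using near(2) by (simp add: divide_right_mono)
  finally show ?thesis by (simp add: \<eta>_def)
qed

lemma loglik_diff_vanishes_if_close:
  fixes p :: "'p::euclidean_space \<Rightarrow> 'a \<Rightarrow> real"
  assumes "open \<Theta>" and fam: "density_family M \<Theta> p" and "\<theta> \<in> \<Theta>"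
    and ddqm: "ddqm_at M p score \<theta>"
    and h: "\<And>n. \<theta> + h n \<in> \<Theta>" "h \<longlonglongrightarrow> 0" and h': "\<And>n. \<theta> + h' n \<in> \<Theta>" "h' \<longlonglongrightarrow> 0"
    and close: "(\<lambda>n. real n * (norm (h n - h' n))\<^sup>2) \<longlonglongrightarrow> 0"
  shows "loglik_diff_vanishes M p (\<lambda>n. \<theta> + h n) (\<lambda>n. \<theta> + h' n)"
  unfolding loglik_diff_vanishes_def
proof (intro allI impI)
  fix \<epsilon> :: real assume \<epsilon>: "\<epsilon> > 0"
  obtain \<delta> C where \<delta>: "\<delta> > 0"
    and lip: "\<And>h h'. norm h < \<delta> \<Longrightarrow> norm h' < \<delta> \<Longrightarrow>
           sq_hellinger M (p (\<theta> + h)) (p (\<theta> + h')) \<le> C * (norm (h - h'))\<^sup>2"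
    using ddqm_locally_lipschitz[OF assms(1-4)] by metis
  define \<eta> where "\<eta> = (1 - exp (- \<epsilon> / 2))\<^sup>2"
  have \<eta>: "\<eta> \<ge> 0" by (simp add: \<eta>_def)
  let ?P = "\<lambda>n. measure (iid_law M p n (\<theta> + h' n)) {X \<in> space (iid_law M p n (\<theta> + h' n)).
      \<bar>log_lik p n (\<theta> + h n) X - log_lik p n (\<theta> + h' n) X\<bar> > ereal \<epsilon>}"
  have "\<forall>\<^sub>F n in sequentially. norm (h n) < \<delta>" "\<forall>\<^sub>F n in sequentially. norm (h' n) < \<delta>"
    using h(2) h'(2) \<delta> by (auto simp: tendsto_iff)
  then have "\<forall>\<^sub>F n in sequentially. norm (?P n) \<le> C / \<eta> * (real n * (norm (h n - h' n))\<^sup>2)"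
  proof eventually_elim
    case (elim n)
    have "?P n \<le> real n * sq_hellinger M (p (\<theta> + h n)) (p (\<theta> + h' n)) / \<eta>"
      unfolding \<eta>_def using fam h(1) h'(1) \<epsilon>
      by (intro loglik_diff_tail_bound) (auto simp: density_family_iff)
    also have "\<dots> \<le> real n * (C * (norm (h n - h' n))\<^sup>2) / \<eta>"
      using lip[OF elim] \<eta> by (intro divide_right_mono mult_left_mono) auto
    finally show ?case by (simp add: mult_ac)
  qed
  then show "?P \<longlonglongrightarrow> 0"
    by (rule Lim_null_comparison) (use tendsto_mult_left[OF close, of "C / \<eta>"] in simp)
qed

section \<open>Approximating one model by the other\<close>

lemma hausdorff_dist_commute: "hausdorff_dist A B = hausdorff_dist B A"
  by (simp add: hausdorff_dist_def max.commute)

lemma c_equivalent_at_sym: "c_equivalent_at c \<theta> M1 M2 \<Longrightarrow> c_equivalent_at c \<theta> M2 M1"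
  by (simp add: c_equivalent_at_def hausdorff_dist_commute)

lemma c_near_equivalent_at_sym: "c_near_equivalent_at c \<theta> M1 M2 \<Longrightarrow> c_near_equivalent_at c \<theta> M2 M1"
  by (simp add: c_near_equivalent_at_def hausdorff_dist_commute)

text \<open>
  The slack \<open>\<eta>\<close> is there because the models are not assumed closed, so the infimum in the
  Hausdorff distance need not be attained.
\<close>

lemma hausdorff_dist_almost_attained:
  fixes \<theta> :: "'p::metric_space"
  assumes "a \<in> M1 \<inter> ball \<theta> \<epsilon>" and "\<theta> \<in> M2" and "\<eta> > 0"
  obtains b where "b \<in> M2 \<inter> ball \<theta> \<epsilon>"
    and "dist a b < hausdorff_dist (M1 \<inter> ball \<theta> \<epsilon>) (M2 \<inter> ball \<theta> \<epsilon>) + \<eta>"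
proof -
  let ?A = "M1 \<inter> ball \<theta> \<epsilon>" and ?B = "M2 \<inter> ball \<theta> \<epsilon>"
  have "\<epsilon> > 0"
    using assms(1) by (auto intro: le_less_trans[OF zero_le_dist])
  then have \<theta>: "\<theta> \<in> ?B" using assms(2) by simp
  have "bdd_above ((\<lambda>a. infdist a ?B) ` ?A)"
  proof (rule bdd_aboveI2)
    fix x assume "x \<in> ?A"
    then show "infdist x ?B \<le> \<epsilon>"
      by (intro infdist_le2[OF \<theta>]) (simp add: dist_commute)
  qed
  with assms(1) have "infdist a ?B \<le> (SUP a\<in>?A. infdist a ?B)"
    by (rule cSUP_upper)
  also have "\<dots> < hausdorff_dist ?A ?B + \<eta>"
    using \<open>\<eta> > 0\<close> by (simp add: hausdorff_dist_def)
  also have "infdist a ?B = (INF b\<in>?B. dist a b)"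
    using \<theta> by (intro infdist_notempty) auto
  finally have "(INF b\<in>?B. dist a b) < hausdorff_dist ?A ?B + \<eta>" .
  then have "\<exists>b\<in>?B. dist a b < hausdorff_dist ?A ?B + \<eta>"
    using \<theta> by (subst (asm) cINF_less_iff) (auto intro: bdd_belowI2[where m = 0])
  then show thesis using that by blast
qed

text \<open>
  Separates the geometry from the probability: for a given class of rates it remains to find radii
  that enclose \<open>h\<^sub>n\<close>, shrink to \<open>0\<close>, and bring the models within \<open>o(n\<^sup>-\<^sup>1\<^sup>/\<^sup>2)\<close> of each other.
\<close>

lemma locally_mimickedI:
  fixes p :: "'p::euclidean_space \<Rightarrow> 'a \<Rightarrow> real"
  assumes "open \<Theta>" and "density_family M \<Theta> p" and "\<theta> \<in> \<Theta>" and "ddqm_at M p score \<theta>"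
    and M1: "M1 \<subseteq> \<Theta>" and M2: "M2 \<subseteq> \<Theta>" "\<theta> \<in> M2"
    and radius: "\<And>h :: nat \<Rightarrow> 'p. (\<lambda>n. norm (h n)) \<in> R \<Longrightarrow>
      \<exists>\<epsilon>. (\<forall>n. norm (h n) < \<epsilon> n) \<and> \<epsilon> \<longlonglongrightarrow> 0 \<and>
        (\<lambda>n. hausdorff_dist (M1 \<inter> ball \<theta> (\<epsilon> n)) (M2 \<inter> ball \<theta> (\<epsilon> n)))
          \<in> o(\<lambda>n. real n powr (- 1/2))"
  shows "locally_mimicked M p \<theta> R M1 M2"
  unfolding locally_mimicked_def
proof (intro allI impI)
  fix h :: "nat \<Rightarrow> 'p"
  assume h: "\<forall>n. \<theta> + h n \<in> M1" and "(\<lambda>n. norm (h n)) \<in> R"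
  then obtain \<epsilon> where \<epsilon>: "\<And>n. norm (h n) < \<epsilon> n" "\<epsilon> \<longlonglongrightarrow> 0"
    and small: "(\<lambda>n. hausdorff_dist (M1 \<inter> ball \<theta> (\<epsilon> n)) (M2 \<inter> ball \<theta> (\<epsilon> n)))
          \<in> o(\<lambda>n. real n powr (- 1/2))"
    using radius[of h] by blast
  define gap where "gap n = hausdorff_dist (M1 \<inter> ball \<theta> (\<epsilon> n)) (M2 \<inter> ball \<theta> (\<epsilon> n))
      + inverse (real (Suc n))" for n
  have "\<exists>k. \<theta> + k \<in> M2 \<and> norm k < \<epsilon> n \<and> norm (h n - k) < gap n" for n
  proof -
    have "\<theta> + h n \<in> M1 \<inter> ball \<theta> (\<epsilon> n)"
      using h \<epsilon>(1) by (simp add: dist_norm)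
    then obtain b where b: "b \<in> M2 \<inter> ball \<theta> (\<epsilon> n)" "dist (\<theta> + h n) b < gap n"
      unfolding gap_def
      using hausdorff_dist_almost_attained[OF _ \<open>\<theta> \<in> M2\<close>, of "\<theta> + h n" M1 "\<epsilon> n" "inverse (real (Suc n))"]
      by auto
    then show ?thesis
      by (intro exI[of _ "b - \<theta>"]) (auto simp: dist_norm norm_minus_commute algebra_simps)
  qed
  then obtain h' where h': "\<And>n. \<theta> + h' n \<in> M2" "\<And>n. norm (h' n) < \<epsilon> n"
      "\<And>n. norm (h n - h' n) < gap n"
    by metis
  have null: "h \<longlonglongrightarrow> 0" "h' \<longlonglongrightarrow> 0"
    using \<epsilon>(1) h'(2) by (auto intro!: Lim_null_comparison[OF _ \<epsilon>(2)] always_eventually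
        intro: less_imp_le)
  have "(\<lambda>n. inverse (real (Suc n))) \<in> o(\<lambda>n. real n powr (- 1/2))"
    by real_asymp
  with small have "gap \<in> o(\<lambda>n. real n powr (- 1/2))"
    unfolding gap_def by (rule sum_in_smallo)
  then have "(\<lambda>n. norm (h n - h' n)) \<in> o(\<lambda>n. real n powr (- 1/2))"
    by (rule landau_o.big_small_trans[rotated])
      (auto intro!: bigoI[where c = 1] always_eventually less_imp_le[OF less_le_trans[OF h'(3)]])
  then have "(\<lambda>n. (norm (h n - h' n) / real n powr (- 1/2))\<^sup>2) \<longlonglongrightarrow> 0\<^sup>2"
    by (intro tendsto_power smalloD_tendsto)
  moreover have "(norm (h n - h' n) / real n powr (- 1/2))\<^sup>2 = real n * (norm (h n - h' n))\<^sup>2"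
    for n
    \<comment> \<open>At \<open>n = 0\<close> both sides are \<open>0\<close>, since \<open>0 powr a = 0\<close> and \<open>x / 0 = 0\<close>.\<close>
    by (cases "n = 0") (simp_all add: power_divide power_mult_distrib powr_minus_divide powr_half_sqrt)
  ultimately have "(\<lambda>n. real n * (norm (h n - h' n))\<^sup>2) \<longlonglongrightarrow> 0"
    by (simp only: zero_power2)
  then have "loglik_diff_vanishes M p (\<lambda>n. \<theta> + h n) (\<lambda>n. \<theta> + h' n)"
    using h h'(1) M1 M2 null by (intro loglik_diff_vanishes_if_close[OF assms(1-4)]) auto
  then show "\<exists>h'. (\<forall>n. \<theta> + h' n \<in> M2) \<and> loglik_diff_vanishes M p (\<lambda>n. \<theta> + h n) (\<lambda>n. \<theta> + h' n)"
    using h'(1) by blast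
qed

lemma bigo_null_trans:
  fixes f g :: "nat \<Rightarrow> real"
  assumes "g \<longlonglongrightarrow> 0" and "f \<in> O(g)"
  shows "f \<longlonglongrightarrow> 0"
proof -
  have "g \<in> o(\<lambda>_. 1)"
    using assms(1) by (intro smalloI_tendsto) auto
  with assms(2) have "f \<in> o(\<lambda>_. 1)"
    by (rule landau_o.big_small_trans)
  then show ?thesis
    using smalloD_tendsto by fastforce
qed

text \<open>
  The radius is \<open>\<parallel>h\<^sub>n\<parallel>\<close> plus a positive sequence of the same admissible order, since the balls
  are open and \<open>h\<^sub>n\<close> may vanish.
\<close>

lemma c_equivalent_imp_locally_mimicked:
  fixes p :: "'p::euclidean_space \<Rightarrow> 'a \<Rightarrow> real"
  assumes "open \<Theta>" and "density_family M \<Theta> p" and "\<theta> \<in> \<Theta>" and "ddqm_at M p score \<theta>"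
    and "M1 \<subseteq> \<Theta>" and "M2 \<subseteq> \<Theta>" and "\<theta> \<in> M2" and c: "c > 0"
    and equiv: "c_equivalent_at c \<theta> M1 M2"
  shows "locally_mimicked M p \<theta> (O(\<lambda>n. real n powr (- 1 / (2 * c)))) M1 M2"
proof (rule locally_mimickedI[OF assms(1-7)])
  fix h :: "nat \<Rightarrow> 'p"
  let ?r = "\<lambda>n. real n powr (- 1 / (2 * c))"
  assume h: "(\<lambda>n. norm (h n)) \<in> O(?r)"
  define \<epsilon> where "\<epsilon> n = norm (h n) + real (Suc n) powr (- 1 / (2 * c))" for n
  have gt: "norm (h n) < \<epsilon> n" for n by (simp add: \<epsilon>_def)
  have pos: "\<epsilon> n > 0" for n using gt[of n] norm_ge_zero[of "h n"] by linarith
  have "(\<lambda>n. real (Suc n) powr (- 1 / (2 * c))) \<in> O(?r)"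
    using c by real_asymp
  with h have rate: "\<epsilon> \<in> O(?r)"
    unfolding \<epsilon>_def by (rule sum_in_bigo)
  have "?r \<longlonglongrightarrow> 0" using c by real_asymp
  then have lim: "\<epsilon> \<longlonglongrightarrow> 0"
    using rate by (rule bigo_null_trans)
  have "(\<lambda>n. \<epsilon> n powr c) \<in> O(\<lambda>n. ?r n powr c)"
    using rate c pos by (intro bigo_powr_nonneg) (auto simp: less_imp_le)
  then have pc: "(\<lambda>n. \<epsilon> n powr c) \<in> O(\<lambda>n. real n powr (- 1/2))"
    using c by (simp add: powr_powr)
  have "filterlim \<epsilon> (at_right 0) sequentially"
    using lim pos by (simp add: filterlim_at less_imp_neq[THEN not_sym])
  with equiv have "(\<lambda>n. hausdorff_dist (M1 \<inter> ball \<theta> (\<epsilon> n)) (M2 \<inter> ball \<theta> (\<epsilon> n))) \<in> o(\<lambda>n. \<epsilon> n powr c)"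
    unfolding c_equivalent_at_def by (rule landau_o.small.compose)
  from landau_o.small_big_trans[OF this pc] gt lim
  show "\<exists>\<epsilon>. (\<forall>n. norm (h n) < \<epsilon> n) \<and> \<epsilon> \<longlonglongrightarrow> 0 \<and>
      (\<lambda>n. hausdorff_dist (M1 \<inter> ball \<theta> (\<epsilon> n)) (M2 \<inter> ball \<theta> (\<epsilon> n))) \<in> o(\<lambda>n. real n powr (- 1/2))"
    by blast
qed

lemma c_near_equivalent_imp_locally_mimicked:
  fixes p :: "'p::euclidean_space \<Rightarrow> 'a \<Rightarrow> real"
  assumes "open \<Theta>" and "density_family M \<Theta> p" and "\<theta> \<in> \<Theta>" and "ddqm_at M p score \<theta>"
    and "M1 \<subseteq> \<Theta>" and "M2 \<subseteq> \<Theta>" and "\<theta> \<in> M2" and c: "c > 0"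
    and equiv: "c_near_equivalent_at c \<theta> M1 M2"
  shows "locally_mimicked M p \<theta> (o(\<lambda>n. real n powr (- 1 / (2 * c)))) M1 M2"
proof (rule locally_mimickedI[OF assms(1-7)])
  fix h :: "nat \<Rightarrow> 'p"
  let ?r = "\<lambda>n. real n powr (- 1 / (2 * c))"
  assume h: "(\<lambda>n. norm (h n)) \<in> o(?r)"
  \<comment> \<open>One more factor \<open>1/n\<close> than the admissible rate makes the added sequence of strictly smaller order.\<close>
  define \<epsilon> where "\<epsilon> n = norm (h n) + real (Suc n) powr (- 1 / (2 * c) - 1)" for n
  have gt: "norm (h n) < \<epsilon> n" for n by (simp add: \<epsilon>_def)
  have pos: "\<epsilon> n > 0" for n using gt[of n] norm_ge_zero[of "h n"] by linarith
  have "(\<lambda>n. real (Suc n) powr (- 1 / (2 * c) - 1)) \<in> o(?r)"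
    using c by real_asymp
  with h have rate: "\<epsilon> \<in> o(?r)"
    unfolding \<epsilon>_def by (rule sum_in_smallo)
  have "?r \<longlonglongrightarrow> 0" using c by real_asymp
  then have lim: "\<epsilon> \<longlonglongrightarrow> 0"
    using landau_o.small_imp_big[OF rate] by (rule bigo_null_trans)
  have "(\<lambda>n. \<epsilon> n powr c) \<in> o(\<lambda>n. ?r n powr c)"
    using rate c pos by (intro smallo_powr_nonneg) (auto simp: less_imp_le)
  then have pc: "(\<lambda>n. \<epsilon> n powr c) \<in> o(\<lambda>n. real n powr (- 1/2))"
    using c by (simp add: powr_powr)
  have "filterlim \<epsilon> (at_right 0) sequentially"
    using lim pos by (simp add: filterlim_at less_imp_neq[THEN not_sym])
  with equiv have "(\<lambda>n. hausdorff_dist (M1 \<inter> ball \<theta> (\<epsilon> n)) (M2 \<inter> ball \<theta> (\<epsilon> n))) \<in> O(\<lambda>n. \<epsilon> n powr c)"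
    unfolding c_near_equivalent_at_def by (rule landau_o.big.compose)
  from landau_o.big_small_trans[OF this pc] gt lim
  show "\<exists>\<epsilon>. (\<forall>n. norm (h n) < \<epsilon> n) \<and> \<epsilon> \<longlonglongrightarrow> 0 \<and>
      (\<lambda>n. hausdorff_dist (M1 \<inter> ball \<theta> (\<epsilon> n)) (M2 \<inter> ball \<theta> (\<epsilon> n))) \<in> o(\<lambda>n. real n powr (- 1/2))"
    by blast
qed

theorem corollary2p11:
  fixes M :: "'a measure"
    and \<Theta> :: "(real ^ 'k) set"
    and p :: "real ^ 'k \<Rightarrow> 'a \<Rightarrow> real"
    and score :: "real ^ 'k \<Rightarrow> 'a \<Rightarrow> real ^ 'k"
    and \<theta> :: "real ^ 'k"
    and M1 M2 :: "(real ^ 'k) set"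
    and c :: real
  assumes "open \<Theta>"
    and "density_family M \<Theta> p"
    and "\<theta> \<in> \<Theta>"
    and "ddqm_at M p score \<theta>"
    and "M1 \<subseteq> \<Theta>" and "M2 \<subseteq> \<Theta>"
    and "\<theta> \<in> M1 \<inter> M2"
    and "c > 0"
  shows "(c_equivalent_at c \<theta> M1 M2 \<longrightarrow>
            not_asymp_distinguishable M p \<theta> (O(\<lambda>n. real n powr (- 1 / (2 * c)))) M1 M2)
       \<and> (c_near_equivalent_at c \<theta> M1 M2 \<longrightarrow>
            not_asymp_distinguishable M p \<theta> (o(\<lambda>n. real n powr (- 1 / (2 * c)))) M1 M2)"
proof -
  have in1: "\<theta> \<in> M1" and in2: "\<theta> \<in> M2"
    using assms(7) by auto
  show ?thesis
    unfolding not_asymp_distinguishable_def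
    using c_equivalent_imp_locally_mimicked[OF assms(1-6) in2 assms(8)]
      c_equivalent_imp_locally_mimicked[OF assms(1-4) assms(6,5) in1 assms(8)]
      c_near_equivalent_imp_locally_mimicked[OF assms(1-6) in2 assms(8)]
      c_near_equivalent_imp_locally_mimicked[OF assms(1-4) assms(6,5) in1 assms(8)]
      c_equivalent_at_sym[of c \<theta> M1 M2] c_near_equivalent_at_sym[of c \<theta> M1 M2]
    by blast
qed

end
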